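(* Let $m,n\in\mathbb{N}=\{0,1,2,\ldots\}$. Then for the Lie algebra $\mathfrak{g}_2$ with simple roots $\alpha_1,\alpha_2$, $$\wp_q(m\alpha_1+n\alpha_2)=\sum_{i=0}^{\min\left(\left\lfloor\frac{m}{3}\right\rfloor,\left\lfloor\frac{n}{2}\right\rfloor\right)}\ \sum_{j=0}^{\min\left(\left\lfloor\frac{m-3i}{3}\right\rfloor,\,n-2i\right)}\ \sum_{k=0}^{\min\left(\left\lfloor\frac{m-3i-3j}{2}\right\rfloor,\,n-2i-j\right)}\ \sum_{l=0}^{\min\left(m-3i-3j-2k,\,n-2i-j-k\right)} q^{z},$$ where $z=m+n-4i-3j-2k-l$.
   Context: The positive roots of $\mathfrak{g}_2$ are $\Phi^+=\{\alpha_1,\ \alpha_2,\ \alpha_1+\alpha_2,\ 2\alpha_1+\alpha_2,\ 3\alpha_1+\alpha_2,\ 3\alpha_1+2\alpha_2\}$. The $q$-analog of Kostant's partition function is the polynomial $\wp_q(\xi)=\sum_{i\ge0}c_iq^i$ in the indeterminate $q$, where $c_i$ is the number of ways to write the weight $\xi$ as a sum of exactly $i$ positive roots (order irrelevant, repetitions allowed, i.e. multisets of $i$ positive roots with sum $\xi$). *)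

theory Defs
  imports "HOL-Analysis.Analysis" "HOL-Computational_Algebra.Polynomial" "HOL-Library.Multiset"
begin

text \<open>
  The weights live in an arbitrary real inner product space. A pair of simple roots of type
  \<open>G\<^sub>2\<close> is characterised by its Cartan integers; \<open>\<alpha>\<^sub>1\<close> is the short root.
\<close>

definition g2_simple_roots :: "'a::real_inner \<Rightarrow> 'a \<Rightarrow> bool" where
  "g2_simple_roots \<alpha>\<^sub>1 \<alpha>\<^sub>2 \<longleftrightarrow>
     \<alpha>\<^sub>1 \<noteq> 0 \<and> \<alpha>\<^sub>2 \<noteq> 0 \<and>
     2 * (\<alpha>\<^sub>2 \<bullet> \<alpha>\<^sub>1) / (\<alpha>\<^sub>1 \<bullet> \<alpha>\<^sub>1) = -3 \<and>
     2 * (\<alpha>\<^sub>1 \<bullet> \<alpha>\<^sub>2) / (\<alpha>\<^sub>2 \<bullet> \<alpha>\<^sub>2) = -1"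

definition g2_positive_roots :: "'a::real_vector \<Rightarrow> 'a \<Rightarrow> 'a set" where
  "g2_positive_roots \<alpha>\<^sub>1 \<alpha>\<^sub>2 =
     {\<alpha>\<^sub>1, \<alpha>\<^sub>2, \<alpha>\<^sub>1 + \<alpha>\<^sub>2, 2 *\<^sub>R \<alpha>\<^sub>1 + \<alpha>\<^sub>2, 3 *\<^sub>R \<alpha>\<^sub>1 + \<alpha>\<^sub>2, 3 *\<^sub>R \<alpha>\<^sub>1 + 2 *\<^sub>R \<alpha>\<^sub>2}"

definition partition_count :: "'a::comm_monoid_add set \<Rightarrow> 'a \<Rightarrow> nat \<Rightarrow> nat" where
  "partition_count P \<xi> i = card {M. set_mset M \<subseteq> P \<and> size M = i \<and> \<Sum>\<^sub># M = \<xi>}"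

text \<open>
  Both the cardinality above and the sum below are meant for sets \<open>P\<close> for which the collections
  in question are finite; for the positive roots of \<open>G\<^sub>2\<close> this is proved at the end of the theory.
\<close>

definition kostant_q :: "'a::comm_monoid_add set \<Rightarrow> 'a \<Rightarrow> int poly" where
  "kostant_q P \<xi> = (\<Sum>i | partition_count P \<xi> i \<noteq> 0. monom (int (partition_count P \<xi> i)) i)"

lemma g2_simple_roots_exist: "g2_simple_roots 1 (Complex (-3/2) (sqrt 3 / 2))"
  by (simp add: g2_simple_roots_def inner_complex_def complex_eq_iff power2_eq_square)

lemma finite_partitions:
  assumes "finite P"
  shows "finite {M. set_mset M \<subseteq> P \<and> size M = i \<and> \<Sum>\<^sub># M = \<xi>}"
proof (rule finite_subset)
  show "{M. set_mset M \<subseteq> P \<and> size M = i \<and> \<Sum>\<^sub># M = \<xi>} \<subseteq> mset ` {xs. set xs \<subseteq> P \<and> length xs = i}"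
  proof
    fix M assume M: "M \<in> {M. set_mset M \<subseteq> P \<and> size M = i \<and> \<Sum>\<^sub># M = \<xi>}"
    obtain xs where "M = mset xs" by (metis ex_mset)
    with M show "M \<in> mset ` {xs. set xs \<subseteq> P \<and> length xs = i}" by auto
  qed
  show "finite (mset ` {xs. set xs \<subseteq> P \<and> length xs = i})"
    using finite_lists_length_eq[OF assms] by simp
qed

lemma finite_support_g2:
  fixes \<alpha>\<^sub>1 \<alpha>\<^sub>2 \<xi> :: "'a::real_inner"
  assumes "g2_simple_roots \<alpha>\<^sub>1 \<alpha>\<^sub>2"
  shows "finite {i. partition_count (g2_positive_roots \<alpha>\<^sub>1 \<alpha>\<^sub>2) \<xi> i \<noteq> 0}"
proof -
  define s where "s = \<alpha>\<^sub>1 \<bullet> \<alpha>\<^sub>1"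
  define v where "v = 5 *\<^sub>R \<alpha>\<^sub>1 + 3 *\<^sub>R \<alpha>\<^sub>2"
  have nz: "\<alpha>\<^sub>1 \<noteq> 0" "\<alpha>\<^sub>2 \<noteq> 0"
    and c1: "2 * (\<alpha>\<^sub>2 \<bullet> \<alpha>\<^sub>1) / (\<alpha>\<^sub>1 \<bullet> \<alpha>\<^sub>1) = -3" and c2: "2 * (\<alpha>\<^sub>1 \<bullet> \<alpha>\<^sub>2) / (\<alpha>\<^sub>2 \<bullet> \<alpha>\<^sub>2) = -1"
    using assms by (auto simp: g2_simple_roots_def)
  have s: "s > 0" using nz by (simp add: s_def)
  have "2 * (\<alpha>\<^sub>2 \<bullet> \<alpha>\<^sub>1) = - 3 * s"
    using c1 nz by (simp add: s_def divide_simps)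
  moreover have "2 * (\<alpha>\<^sub>1 \<bullet> \<alpha>\<^sub>2) = - (\<alpha>\<^sub>2 \<bullet> \<alpha>\<^sub>2)"
    using c2 nz by (simp add: divide_simps)
  ultimately have e: "\<alpha>\<^sub>2 \<bullet> \<alpha>\<^sub>1 = - 3/2 * s" "\<alpha>\<^sub>1 \<bullet> \<alpha>\<^sub>2 = - 3/2 * s" "\<alpha>\<^sub>2 \<bullet> \<alpha>\<^sub>2 = 3 * s"
    by (simp_all add: inner_commute)
  have v1: "\<alpha>\<^sub>1 \<bullet> v = s / 2" and v2: "\<alpha>\<^sub>2 \<bullet> v = 3 * s / 2"
    by (simp_all add: v_def inner_add_right e s_def[symmetric])
  have root: "s / 2 \<le> x \<bullet> v" if "x \<in> g2_positive_roots \<alpha>\<^sub>1 \<alpha>\<^sub>2" for x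
    using that s by (auto simp: g2_positive_roots_def inner_add_left v1 v2)
  have bound: "real (size M) * (s / 2) \<le> \<Sum>\<^sub># M \<bullet> v" if "set_mset M \<subseteq> g2_positive_roots \<alpha>\<^sub>1 \<alpha>\<^sub>2" for M
    using that
  proof (induction M)
    case (add x M)
    then have "real (size M) * (s / 2) \<le> \<Sum>\<^sub># M \<bullet> v" "s / 2 \<le> x \<bullet> v" using root by auto
    then show ?case by (simp add: inner_add_left algebra_simps add_divide_distrib)
  qed simp
  have "{i. partition_count (g2_positive_roots \<alpha>\<^sub>1 \<alpha>\<^sub>2) \<xi> i \<noteq> 0} \<subseteq> {i. real i \<le> \<xi> \<bullet> v / (s / 2)}"
  proof
    fix i assume "i \<in> {i. partition_count (g2_positive_roots \<alpha>\<^sub>1 \<alpha>\<^sub>2) \<xi> i \<noteq> 0}"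
    then have "{M. set_mset M \<subseteq> g2_positive_roots \<alpha>\<^sub>1 \<alpha>\<^sub>2 \<and> size M = i \<and> \<Sum>\<^sub># M = \<xi>} \<noteq> {}"
      unfolding partition_count_def by (metis (mono_tags, lifting) card.empty mem_Collect_eq)
    then obtain M where "set_mset M \<subseteq> g2_positive_roots \<alpha>\<^sub>1 \<alpha>\<^sub>2" "size M = i" "\<Sum>\<^sub># M = \<xi>" by blast
    then have "real i * (s / 2) \<le> \<xi> \<bullet> v" using bound by blast
    then show "i \<in> {i. real i \<le> \<xi> \<bullet> v / (s / 2)}" using s by (simp add: pos_le_divide_eq)
  qed
  moreover have "finite {i. real i \<le> \<xi> \<bullet> v / (s / 2)}"
    by (rule finite_subset[of _ "{.. nat \<lfloor>\<xi> \<bullet> v / (s / 2)\<rfloor>}"]) (auto simp: le_nat_floor)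
  ultimately show ?thesis by (rule finite_subset)
qed

lemma coeff_kostant_q_g2:
  fixes \<alpha>\<^sub>1 \<alpha>\<^sub>2 \<xi> :: "'a::real_inner"
  assumes "g2_simple_roots \<alpha>\<^sub>1 \<alpha>\<^sub>2"
  shows "coeff (kostant_q (g2_positive_roots \<alpha>\<^sub>1 \<alpha>\<^sub>2) \<xi>) i
           = int (partition_count (g2_positive_roots \<alpha>\<^sub>1 \<alpha>\<^sub>2) \<xi> i)"
  using finite_support_g2[OF assms, of \<xi>]
  by (simp add: kostant_q_def coeff_sum sum.delta)

end

theory Submission
  imports Defs
begin

text \<open>
  The two simple roots are linearly independent, so every vector in the lattice they span has unique
  coordinates and the six positive roots are pairwise distinct. A multiset of positive roots is
  therefore the same thing as six multiplicities. Write \<open>i\<close>, \<open>j\<close>, \<open>k\<close>, \<open>l\<close> for those of the non-simple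
  roots \<open>3\<alpha>\<^sub>1 + 2\<alpha>\<^sub>2\<close>, \<open>3\<alpha>\<^sub>1 + \<alpha>\<^sub>2\<close>, \<open>2\<alpha>\<^sub>1 + \<alpha>\<^sub>2\<close>, \<open>\<alpha>\<^sub>1 + \<alpha>\<^sub>2\<close>. If the sum of the multiset is
  \<open>m\<alpha>\<^sub>1 + n\<alpha>\<^sub>2\<close>, comparing coordinates forces the multiplicities of \<open>\<alpha>\<^sub>1\<close> and \<open>\<alpha>\<^sub>2\<close> to be
  \<open>m - (3i + 3j + 2k + l)\<close> and \<open>n - (2i + j + k + l)\<close>; conversely any \<open>(i, j, k, l)\<close> for which these two
  differences are nonnegative occurs. The number of parts is then \<open>m + n - 4i - 3j - 2k - l\<close>.

  Since \<open>kostant_q\<close> is the sum of \<open>q\<close> to the number of parts over all partitions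
  (\<open>kostant_q_eq_sum_partitions\<close>), this bijection (\<open>bij_betw_g2_partition\<close>) turns it into a sum over the
  admissible quadruples, and the bounds of the nested sum describe exactly these, one coordinate at a
  time (\<open>nested_sum_g2_quadruples\<close>).
\<close>

definition partitions :: "'a::comm_monoid_add set \<Rightarrow> 'a \<Rightarrow> 'a multiset set" where
  "partitions P \<xi> = {M. set_mset M \<subseteq> P \<and> \<Sum>\<^sub># M = \<xi>}"

text \<open>
  Grouping the partitions by their number of parts. Finiteness makes the support of
  \<open>partition_count\<close> exactly the set of sizes that occur.
\<close>

lemma kostant_q_eq_sum_partitions:
  assumes fin: "finite (partitions P \<xi>)"
  shows "kostant_q P \<xi> = (\<Sum>M\<in>partitions P \<xi>. monom 1 (size M))"
proof -
  have count: "partition_count P \<xi> i = card {M \<in> partitions P \<xi>. size M = i}" for i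
    unfolding partition_count_def partitions_def by (rule arg_cong[where f = card]) auto
  have supp: "{i. partition_count P \<xi> i \<noteq> 0} = size ` partitions P \<xi>"
    using fin by (auto simp: count card_eq_0_iff)
  have term_eq: "monom (int (partition_count P \<xi> i)) i
      = (\<Sum>M | M \<in> partitions P \<xi> \<and> size M = i. monom 1 (size M))" for i
    by (simp add: count of_nat_poly smult_monom)
  have "kostant_q P \<xi> = (\<Sum>i\<in>size ` partitions P \<xi>.
      \<Sum>M | M \<in> partitions P \<xi> \<and> size M = i. monom 1 (size M))"
    unfolding kostant_q_def supp term_eq ..
  also have "\<dots> = (\<Sum>M\<in>partitions P \<xi>. monom 1 (size M))"
    using fin by (intro sum.group) auto
  finally show ?thesis .
qed

text \<open>The Gram determinant of two simple roots of type \<open>G\<^sub>2\<close> is a positive multiple of \<open>|\<alpha>\<^sub>1|\<^sup>4\<close>.\<close>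

lemma g2_simple_roots_coords_eq_iff:
  fixes \<alpha>\<^sub>1 \<alpha>\<^sub>2 :: "'a::real_inner"
  assumes "g2_simple_roots \<alpha>\<^sub>1 \<alpha>\<^sub>2"
  shows "x *\<^sub>R \<alpha>\<^sub>1 + y *\<^sub>R \<alpha>\<^sub>2 = x' *\<^sub>R \<alpha>\<^sub>1 + y' *\<^sub>R \<alpha>\<^sub>2 \<longleftrightarrow> x = x' \<and> y = y'"
proof
  define s where "s = \<alpha>\<^sub>1 \<bullet> \<alpha>\<^sub>1"
  have nz: "\<alpha>\<^sub>1 \<noteq> 0" "\<alpha>\<^sub>2 \<noteq> 0"
    and c: "2 * (\<alpha>\<^sub>2 \<bullet> \<alpha>\<^sub>1) / (\<alpha>\<^sub>1 \<bullet> \<alpha>\<^sub>1) = -3" "2 * (\<alpha>\<^sub>1 \<bullet> \<alpha>\<^sub>2) / (\<alpha>\<^sub>2 \<bullet> \<alpha>\<^sub>2) = -1"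
    using assms by (auto simp: g2_simple_roots_def)
  have s: "s \<noteq> 0" using nz by (simp add: s_def)
  have "2 * (\<alpha>\<^sub>2 \<bullet> \<alpha>\<^sub>1) = - 3 * s"
    using c nz by (simp add: s_def divide_simps)
  moreover have "2 * (\<alpha>\<^sub>1 \<bullet> \<alpha>\<^sub>2) = - (\<alpha>\<^sub>2 \<bullet> \<alpha>\<^sub>2)"
    using c nz by (simp add: divide_simps)
  ultimately have gram: "\<alpha>\<^sub>2 \<bullet> \<alpha>\<^sub>1 = - 3/2 * s" "\<alpha>\<^sub>1 \<bullet> \<alpha>\<^sub>2 = - 3/2 * s" "\<alpha>\<^sub>2 \<bullet> \<alpha>\<^sub>2 = 3 * s"
    by (simp_all add: inner_commute)
  assume eq: "x *\<^sub>R \<alpha>\<^sub>1 + y *\<^sub>R \<alpha>\<^sub>2 = x' *\<^sub>R \<alpha>\<^sub>1 + y' *\<^sub>R \<alpha>\<^sub>2"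
  define u v where "u = x - x'" and "v = y - y'"
  have z: "u *\<^sub>R \<alpha>\<^sub>1 + v *\<^sub>R \<alpha>\<^sub>2 = 0"
    using eq by (simp add: u_def v_def algebra_simps)
  have "(u *\<^sub>R \<alpha>\<^sub>1 + v *\<^sub>R \<alpha>\<^sub>2) \<bullet> \<alpha>\<^sub>1 = (u - 3/2 * v) * s"
    by (simp add: inner_add_left gram s_def[symmetric] algebra_simps)
  with z s have 1: "u - 3/2 * v = 0" by simp
  have "(u *\<^sub>R \<alpha>\<^sub>1 + v *\<^sub>R \<alpha>\<^sub>2) \<bullet> \<alpha>\<^sub>2 = (3 * v - 3/2 * u) * s"
    by (simp add: inner_add_left gram algebra_simps)
  with z s have 2: "3 * v - 3/2 * u = 0" by simp
  show "x = x' \<and> y = y'" using 1 2 by (simp add: u_def v_def)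
qed simp

lemma g2_positive_roots_distinct:
  fixes \<alpha>\<^sub>1 \<alpha>\<^sub>2 :: "'a::real_inner"
  assumes "g2_simple_roots \<alpha>\<^sub>1 \<alpha>\<^sub>2"
  shows "distinct [\<alpha>\<^sub>1, \<alpha>\<^sub>2, \<alpha>\<^sub>1 + \<alpha>\<^sub>2, 2 *\<^sub>R \<alpha>\<^sub>1 + \<alpha>\<^sub>2, 3 *\<^sub>R \<alpha>\<^sub>1 + \<alpha>\<^sub>2, 3 *\<^sub>R \<alpha>\<^sub>1 + 2 *\<^sub>R \<alpha>\<^sub>2]"
proof -
  define f :: "real \<times> real \<Rightarrow> 'a" where "f = (\<lambda>(x, y). x *\<^sub>R \<alpha>\<^sub>1 + y *\<^sub>R \<alpha>\<^sub>2)"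
  have "inj f"
    by (auto simp: inj_on_def f_def g2_simple_roots_coords_eq_iff[OF assms])
  then have "distinct (map f [(1,0), (0,1), (1,1), (2,1), (3,1), (3,2)])"
    by (simp add: inj_eq)
  then show ?thesis by (simp add: f_def)
qed

definition g2_multiset :: "'a::real_vector \<Rightarrow> 'a \<Rightarrow> nat \<Rightarrow> nat \<Rightarrow> nat \<Rightarrow> nat \<Rightarrow> nat \<Rightarrow> nat \<Rightarrow> 'a multiset" where
  "g2_multiset \<alpha>\<^sub>1 \<alpha>\<^sub>2 a b l k j i =
     replicate_mset a \<alpha>\<^sub>1 + replicate_mset b \<alpha>\<^sub>2 + replicate_mset l (\<alpha>\<^sub>1 + \<alpha>\<^sub>2) +
     replicate_mset k (2 *\<^sub>R \<alpha>\<^sub>1 + \<alpha>\<^sub>2) + replicate_mset j (3 *\<^sub>R \<alpha>\<^sub>1 + \<alpha>\<^sub>2) +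
     replicate_mset i (3 *\<^sub>R \<alpha>\<^sub>1 + 2 *\<^sub>R \<alpha>\<^sub>2)"

lemma sum_mset_replicate_mset_scaleR:
  "\<Sum>\<^sub># (replicate_mset c x) = real c *\<^sub>R (x :: 'a::real_vector)"
  by (induction c) (auto simp: algebra_simps)

lemma sum_g2_multiset:
  "\<Sum>\<^sub># (g2_multiset \<alpha>\<^sub>1 \<alpha>\<^sub>2 a b l k j i) =
     real (a + l + 2*k + 3*j + 3*i) *\<^sub>R \<alpha>\<^sub>1 + real (b + l + k + j + 2*i) *\<^sub>R \<alpha>\<^sub>2"
  by (simp add: g2_multiset_def sum_mset_replicate_mset_scaleR algebra_simps)

lemma set_g2_multiset: "set_mset (g2_multiset \<alpha>\<^sub>1 \<alpha>\<^sub>2 a b l k j i) \<subseteq> g2_positive_roots \<alpha>\<^sub>1 \<alpha>\<^sub>2"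
  by (auto simp: g2_multiset_def g2_positive_roots_def split: if_splits)

lemma size_g2_multiset: "size (g2_multiset \<alpha>\<^sub>1 \<alpha>\<^sub>2 a b l k j i) = a + b + l + k + j + i"
  by (simp add: g2_multiset_def)

lemma count_g2_multiset:
  fixes \<alpha>\<^sub>1 \<alpha>\<^sub>2 :: "'a::real_inner"
  assumes "g2_simple_roots \<alpha>\<^sub>1 \<alpha>\<^sub>2"
  shows "count (g2_multiset \<alpha>\<^sub>1 \<alpha>\<^sub>2 a b l k j i) \<alpha>\<^sub>1 = a"
    "count (g2_multiset \<alpha>\<^sub>1 \<alpha>\<^sub>2 a b l k j i) \<alpha>\<^sub>2 = b"
    "count (g2_multiset \<alpha>\<^sub>1 \<alpha>\<^sub>2 a b l k j i) (\<alpha>\<^sub>1 + \<alpha>\<^sub>2) = l"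
    "count (g2_multiset \<alpha>\<^sub>1 \<alpha>\<^sub>2 a b l k j i) (2 *\<^sub>R \<alpha>\<^sub>1 + \<alpha>\<^sub>2) = k"
    "count (g2_multiset \<alpha>\<^sub>1 \<alpha>\<^sub>2 a b l k j i) (3 *\<^sub>R \<alpha>\<^sub>1 + \<alpha>\<^sub>2) = j"
    "count (g2_multiset \<alpha>\<^sub>1 \<alpha>\<^sub>2 a b l k j i) (3 *\<^sub>R \<alpha>\<^sub>1 + 2 *\<^sub>R \<alpha>\<^sub>2) = i"
  using g2_positive_roots_distinct[OF assms] by (auto simp: g2_multiset_def)

lemma g2_multiset_count:
  fixes \<alpha>\<^sub>1 \<alpha>\<^sub>2 :: "'a::real_inner"
  assumes "g2_simple_roots \<alpha>\<^sub>1 \<alpha>\<^sub>2" and "set_mset M \<subseteq> g2_positive_roots \<alpha>\<^sub>1 \<alpha>\<^sub>2"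
  shows "g2_multiset \<alpha>\<^sub>1 \<alpha>\<^sub>2 (count M \<alpha>\<^sub>1) (count M \<alpha>\<^sub>2) (count M (\<alpha>\<^sub>1 + \<alpha>\<^sub>2))
    (count M (2 *\<^sub>R \<alpha>\<^sub>1 + \<alpha>\<^sub>2)) (count M (3 *\<^sub>R \<alpha>\<^sub>1 + \<alpha>\<^sub>2)) (count M (3 *\<^sub>R \<alpha>\<^sub>1 + 2 *\<^sub>R \<alpha>\<^sub>2)) = M"
    (is "?N = M")
proof (rule multiset_eqI)
  fix x
  show "count ?N x = count M x"
  proof (cases "x \<in> g2_positive_roots \<alpha>\<^sub>1 \<alpha>\<^sub>2")
    case True
    then show ?thesis
      using count_g2_multiset[OF assms(1)] by (auto simp: g2_positive_roots_def)
  next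
    case False
    then have "x \<notin># ?N" "x \<notin># M"
      using assms(2) set_g2_multiset by blast+
    then show ?thesis by (simp add: not_in_iff)
  qed
qed

definition g2_quadruples :: "nat \<Rightarrow> nat \<Rightarrow> (nat \<times> nat \<times> nat \<times> nat) set" where
  "g2_quadruples m n = {(i, j, k, l). 3*i + 3*j + 2*k + l \<le> m \<and> 2*i + j + k + l \<le> n}"

definition g2_partition :: "'a::real_vector \<Rightarrow> 'a \<Rightarrow> nat \<Rightarrow> nat \<Rightarrow> nat \<times> nat \<times> nat \<times> nat \<Rightarrow> 'a multiset" where
  "g2_partition \<alpha>\<^sub>1 \<alpha>\<^sub>2 m n = (\<lambda>(i, j, k, l).
     g2_multiset \<alpha>\<^sub>1 \<alpha>\<^sub>2 (m - (3*i + 3*j + 2*k + l)) (n - (2*i + j + k + l)) l k j i)"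

lemma size_g2_partition:
  assumes "(i, j, k, l) \<in> g2_quadruples m n"
  shows "size (g2_partition \<alpha>\<^sub>1 \<alpha>\<^sub>2 m n (i, j, k, l)) = m + n - 4*i - 3*j - 2*k - l"
  using assms by (auto simp: g2_partition_def size_g2_multiset g2_quadruples_def)

text \<open>
  The multiplicities of the four non-simple roots can be read off from the multiset, which gives
  injectivity; surjectivity is the comparison of coordinates, which determines the multiplicities of
  the simple roots.
\<close>

lemma bij_betw_g2_partition:
  fixes \<alpha>\<^sub>1 \<alpha>\<^sub>2 :: "'a::real_inner"
  assumes g2: "g2_simple_roots \<alpha>\<^sub>1 \<alpha>\<^sub>2"
  shows "bij_betw (g2_partition \<alpha>\<^sub>1 \<alpha>\<^sub>2 m n) (g2_quadruples m n)
    (partitions (g2_positive_roots \<alpha>\<^sub>1 \<alpha>\<^sub>2) (real m *\<^sub>R \<alpha>\<^sub>1 + real n *\<^sub>R \<alpha>\<^sub>2))"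
    (is "bij_betw ?f ?Q ?S")
proof (rule bij_betw_imageI)
  define mult where "mult M = (count M (3 *\<^sub>R \<alpha>\<^sub>1 + 2 *\<^sub>R \<alpha>\<^sub>2), count M (3 *\<^sub>R \<alpha>\<^sub>1 + \<alpha>\<^sub>2),
    count M (2 *\<^sub>R \<alpha>\<^sub>1 + \<alpha>\<^sub>2), count M (\<alpha>\<^sub>1 + \<alpha>\<^sub>2))" for M
  have "mult (?f p) = p" for p
    by (cases p) (simp add: mult_def g2_partition_def count_g2_multiset[OF g2])
  then show "inj_on ?f ?Q" by (rule inj_on_inverseI)
  show "?f ` ?Q = ?S"
  proof (intro equalityI subsetI)
    fix M assume "M \<in> ?f ` ?Q"
    then obtain i j k l where Q: "(i, j, k, l) \<in> ?Q" and M: "M = ?f (i, j, k, l)" by auto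
    have "\<Sum>\<^sub># M = real m *\<^sub>R \<alpha>\<^sub>1 + real n *\<^sub>R \<alpha>\<^sub>2"
      using Q unfolding M g2_partition_def prod.case sum_g2_multiset
        g2_simple_roots_coords_eq_iff[OF g2] of_nat_eq_iff by (simp add: g2_quadruples_def)
    then show "M \<in> ?S"
      using set_g2_multiset by (simp add: M g2_partition_def partitions_def)
  next
    fix M assume M: "M \<in> ?S"
    obtain i j k l where p: "mult M = (i, j, k, l)" by (cases "mult M")
    define a b where "a = count M \<alpha>\<^sub>1" and "b = count M \<alpha>\<^sub>2"
    have eq: "M = g2_multiset \<alpha>\<^sub>1 \<alpha>\<^sub>2 a b l k j i"
      using M p g2_multiset_count[OF g2, of M] by (simp add: partitions_def mult_def a_def b_def)
    have "real (a + l + 2*k + 3*j + 3*i) *\<^sub>R \<alpha>\<^sub>1 + real (b + l + k + j + 2*i) *\<^sub>R \<alpha>\<^sub>2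
        = real m *\<^sub>R \<alpha>\<^sub>1 + real n *\<^sub>R \<alpha>\<^sub>2"
      using M unfolding sum_g2_multiset[symmetric] eq[symmetric] by (simp add: partitions_def)
    then have "m = a + l + 2*k + 3*j + 3*i" "n = b + l + k + j + 2*i"
      unfolding g2_simple_roots_coords_eq_iff[OF g2] of_nat_eq_iff by simp_all
    then have "(i, j, k, l) \<in> ?Q" "?f (i, j, k, l) = M"
      by (simp_all add: g2_quadruples_def g2_partition_def eq)
    then show "M \<in> ?f ` ?Q" by (metis imageI)
  qed
qed

text \<open>
  Each bound in the nested sum is what the two inequalities defining \<open>g2_quadruples\<close> leave for the
  next coordinate once the previous ones are chosen and the later ones are set to zero.
\<close>

lemma g2_quadruples_eq_Sigma:
  "g2_quadruples m n =
    (SIGMA i : {0..min (m div 3) (n div 2)}.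
      SIGMA j : {0..min ((m - 3*i) div 3) (n - 2*i)}.
        SIGMA k : {0..min ((m - 3*i - 3*j) div 2) (n - 2*i - j)}.
          {0..min (m - 3*i - 3*j - 2*k) (n - 2*i - j - k)})"
proof -
  have "(i \<le> m div 3 \<and> i \<le> n div 2) \<longleftrightarrow> (3*i \<le> m \<and> 2*i \<le> n)"
    and "(3*i \<le> m \<and> 2*i \<le> n) \<and> (j \<le> (m - 3*i) div 3 \<and> j \<le> n - 2*i) \<longleftrightarrow>
      (3*i + 3*j \<le> m \<and> 2*i + j \<le> n)"
    and "(3*i + 3*j \<le> m \<and> 2*i + j \<le> n) \<and>
        (k \<le> (m - 3*i - 3*j) div 2 \<and> k \<le> n - 2*i - j) \<longleftrightarrow>
      (3*i + 3*j + 2*k \<le> m \<and> 2*i + j + k \<le> n)"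
    and "(3*i + 3*j + 2*k \<le> m \<and> 2*i + j + k \<le> n) \<and>
        (l \<le> m - 3*i - 3*j - 2*k \<and> l \<le> n - 2*i - j - k) \<longleftrightarrow>
      (3*i + 3*j + 2*k + l \<le> m \<and> 2*i + j + k + l \<le> n)" for i j k l
    by (auto simp: less_eq_div_iff_mult_less_eq)
  then have "(3*i + 3*j + 2*k + l \<le> m \<and> 2*i + j + k + l \<le> n) \<longleftrightarrow>
      i \<le> m div 3 \<and> i \<le> n div 2 \<and> j \<le> (m - 3*i) div 3 \<and> j \<le> n - 2*i \<and>
      k \<le> (m - 3*i - 3*j) div 2 \<and> k \<le> n - 2*i - j \<and>
      l \<le> m - 3*i - 3*j - 2*k \<and> l \<le> n - 2*i - j - k" for i j k l
    by metis
  then show ?thesis by (auto simp: g2_quadruples_def)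
qed

lemma nested_sum_g2_quadruples:
  fixes f :: "nat \<Rightarrow> nat \<Rightarrow> nat \<Rightarrow> nat \<Rightarrow> 'a::comm_monoid_add"
  shows "(\<Sum>i = 0..min (m div 3) (n div 2).
      \<Sum>j = 0..min ((m - 3*i) div 3) (n - 2*i).
        \<Sum>k = 0..min ((m - 3*i - 3*j) div 2) (n - 2*i - j).
          \<Sum>l = 0..min (m - 3*i - 3*j - 2*k) (n - 2*i - j - k). f i j k l)
    = (\<Sum>(i, j, k, l)\<in>g2_quadruples m n. f i j k l)"
  unfolding g2_quadruples_eq_Sigma by (simp add: sum.Sigma del: min.bounded_iff)

theorem proposition1p1:
  fixes \<alpha>\<^sub>1 \<alpha>\<^sub>2 :: "'a::real_inner" and m n :: nat
  assumes "g2_simple_roots \<alpha>\<^sub>1 \<alpha>\<^sub>2"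
  shows "kostant_q (g2_positive_roots \<alpha>\<^sub>1 \<alpha>\<^sub>2) (real m *\<^sub>R \<alpha>\<^sub>1 + real n *\<^sub>R \<alpha>\<^sub>2) =
    (\<Sum>i = 0..min (m div 3) (n div 2).
      \<Sum>j = 0..min ((m - 3*i) div 3) (n - 2*i).
        \<Sum>k = 0..min ((m - 3*i - 3*j) div 2) (n - 2*i - j).
          \<Sum>l = 0..min (m - 3*i - 3*j - 2*k) (n - 2*i - j - k).
            monom 1 (m + n - 4*i - 3*j - 2*k - l))"
proof -
  let ?P = "partitions (g2_positive_roots \<alpha>\<^sub>1 \<alpha>\<^sub>2) (real m *\<^sub>R \<alpha>\<^sub>1 + real n *\<^sub>R \<alpha>\<^sub>2)"
  note bij = bij_betw_g2_partition[OF assms, of m n]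
  have "finite (g2_quadruples m n)"
    unfolding g2_quadruples_eq_Sigma by (intro finite_SigmaI finite_atLeastAtMost)
  with bij have "finite ?P" by (simp add: bij_betw_finite)
  then have "kostant_q (g2_positive_roots \<alpha>\<^sub>1 \<alpha>\<^sub>2) (real m *\<^sub>R \<alpha>\<^sub>1 + real n *\<^sub>R \<alpha>\<^sub>2)
      = (\<Sum>M\<in>?P. monom 1 (size M))"
    by (rule kostant_q_eq_sum_partitions)
  also have "\<dots> = (\<Sum>p\<in>g2_quadruples m n. monom 1 (size (g2_partition \<alpha>\<^sub>1 \<alpha>\<^sub>2 m n p)))"
    using sum.reindex_bij_betw[OF bij, of "\<lambda>M. monom (1::int) (size M)"] by simp
  also have "\<dots> = (\<Sum>(i, j, k, l)\<in>g2_quadruples m n. monom 1 (m + n - 4*i - 3*j - 2*k - l))"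
    by (intro sum.cong refl) (auto simp: size_g2_partition)
  finally show ?thesis unfolding nested_sum_g2_quadruples .
qed

end
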